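(* There exists $N \in \mathbb{N}$ such that for all integers $n \geq N$ and all real $t > 0$, $$\left| a_n\!\left(e^{-t\frac{1+z}{1-z}}\right)\right| \leq \frac{2}{e},$$ where $a_n\!\left(e^{-t\frac{1+z}{1-z}}\right)$ is the $n$-th Taylor coefficient at $z=0$ of the function $z \mapsto e^{-t\frac{1+z}{1-z}}$.
   Context: For a function $f(z) = \sum_{k=0}^\infty a_k z^k$ analytic in the open unit disk, $a_n(f)$ denotes the Taylor coefficient $a_n$. Here $e$ is Euler's number. *)

theory Defs
  imports "HOL-Complex_Analysis.Complex_Analysis"
begin

end

theory Submission
  imports Defs
begin

text \<open>Write \<open>a\<^sub>n\<close> for the coefficients. The equation \<open>(1 - z)^2 f' = -2 t f\<close> gives
  \<open>(n+1) a\<^bsub>n+1\<^esub> + (n-1) a\<^bsub>n-1\<^esub> = 2 (n-t) a\<^sub>n\<close>. Hence, with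
  \<open>y = 2 (n-t) / n\<close> and up to errors \<open>O(1/n)\<close> uniform in \<open>t\<close> (when \<open>a\<^sub>n\<close> is not small),
  \<open>a\<^bsub>n+1\<^esub> + a\<^bsub>n-1\<^esub> = y a\<^sub>n\<close> and \<open>a\<^bsub>n+2\<^esub> + a\<^bsub>n-2\<^esub> = (y^2 - 2) a\<^sub>n\<close>.
  Since \<open>f\<close> is bounded by 1 on the disc, the squares of these five coefficients sum to at most 1, so
  \<open>a\<^sub>n^2 (1 + y^2/2 + (y^2-2)^2/2) \<le> 1 + O(1/n)\<close>. The bracket is at least \<open>15/8\<close>, which exceeds
  \<open>e^2/4\<close>.\<close>

text \<open>Since (1+z)/(1-z) = 1 + 2z/(1-z), these are exp(-t) times the generalized Laguerre
  polynomials of parameter -1 at 2t. All of them are real, so the estimates can stay in real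
  arithmetic.\<close>

fun inner_coeff :: "real \<Rightarrow> nat \<Rightarrow> real" where
  "inner_coeff t 0 = exp (- t)"
| "inner_coeff t (Suc 0) = - 2 * t * exp (- t)"
| "inner_coeff t (Suc (Suc n)) =
     (2 * (real n + 1 - t) * inner_coeff t (Suc n) - real n * inner_coeff t n) / (real n + 2)"

lemma inner_coeff_recurrence:
  "(real n + 2) * inner_coeff t (Suc (Suc n)) =
     2 * (real n + 1 - t) * inner_coeff t (Suc n) - real n * inner_coeff t n"
  by simp

declare inner_coeff.simps(3) [simp del]

lemma fps_nth_inner_function:
  fixes t :: real and n :: nat
  defines "f \<equiv> \<lambda>z::complex. exp (- (of_real t * ((1 + z) / (1 - z))))"
  shows "fps_nth (fps_expansion f 0) n = of_real (inner_coeff t n)"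
proof -
  define F where "F = fps_expansion f 0"
  have "f holomorphic_on ball 0 1"
    unfolding f_def by (intro holomorphic_intros) auto
  then have expF: "f has_fps_expansion F"
    unfolding F_def
    by (intro has_fps_expansion_fps_expansion[of "ball 0 1"]) auto
  have deriv_f: "(1 - z)\<^sup>2 * deriv f z = - 2 * of_real t * f z" if "z \<in> ball 0 1" for z
  proof -
    have "z \<noteq> 1"
      using that by auto
    then have "(f has_field_derivative - (2 * of_real t / (1 - z)\<^sup>2) * f z) (at z)"
      unfolding f_def
      by (auto intro!: derivative_eq_intros simp: divide_simps power2_eq_square)
         (simp add: algebra_simps)
    then have "deriv f z = - (2 * of_real t / (1 - z)\<^sup>2) * f z"
      by (rule DERIV_imp_deriv)
    then show ?thesis
      using \<open>z \<noteq> 1\<close> by simp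
  qed
  have "(\<lambda>z. (1 - z)\<^sup>2 * deriv f z) has_fps_expansion (1 - fps_X)\<^sup>2 * fps_deriv F"
    by (intro fps_expansion_intros expF)
  moreover have "(\<lambda>z. (- 2 * of_real t) * f z) has_fps_expansion fps_const (- 2 * of_real t) * F"
    by (intro fps_expansion_intros expF)
  moreover have "\<forall>\<^sub>F z in nhds 0. (1 - z)\<^sup>2 * deriv f z = (- 2 * of_real t) * f z"
    by (rule eventually_mono[OF eventually_nhds_in_open[of "ball 0 1"]]) (use deriv_f in auto)
  then have "(\<lambda>z. (1 - z)\<^sup>2 * deriv f z) has_fps_expansion G
      \<longleftrightarrow> (\<lambda>z. (- 2 * of_real t) * f z) has_fps_expansion G" for G
    by (intro has_fps_expansion_cong refl)
  ultimately have ode: "(1 - fps_X)\<^sup>2 * fps_deriv F = fps_const (- 2 * of_real t) * F"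
    by (meson fps_expansion_unique_complex)
  have F0: "fps_nth F 0 = of_real (exp (- t))"
    unfolding F_def fps_expansion_def f_def by (simp flip: exp_of_real)
  \<comment> \<open>In this form each factor \<open>fps_X\<close> is an index shift, so comparing
    coefficients yields the recurrence directly.\<close>
  have expand: "(1 - fps_X)\<^sup>2 * fps_deriv F =
      fps_deriv F - fps_const 2 * (fps_X * fps_deriv F) + fps_X * (fps_X * fps_deriv F)"
    by (simp add: power2_eq_square algebra_simps numeral_fps_const flip: fps_const_add)
  have rec0: "fps_nth F (Suc 0) = - 2 * of_real t * fps_nth F 0"
    using arg_cong[OF ode[unfolded expand], of "\<lambda>G. fps_nth G 0"] by simp
  have rec: "(of_nat n + 2) * fps_nth F (Suc (Suc n)) =
      2 * (of_nat n + 1 - of_real t) * fps_nth F (Suc n) - of_nat n * fps_nth F n" for n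
    using arg_cong[OF ode[unfolded expand], of "\<lambda>G. fps_nth G (Suc n)"]
    by (cases n) (auto simp: algebra_simps)
  have "fps_nth F n = of_real (inner_coeff t n)"
  proof (induction n rule: induct_nat_012)
    case (ge2 n)
    have "(of_nat n + 2) * fps_nth F (Suc (Suc n)) =
        of_real ((real n + 2) * inner_coeff t (Suc (Suc n)))"
      unfolding rec ge2 inner_coeff_recurrence by simp
    moreover have "(of_nat n + 2 :: complex) \<noteq> 0"
      using of_nat_eq_0_iff[of "n + 2", where 'a = complex] by (simp add: add.commute)
    ultimately show ?case
      by simp
  qed (use F0 rec0 in auto)
  then show ?thesis
    by (simp add: F_def)
qed

text \<open>Coefficient of z^n in (1-z) f' = -2t f/(1-z), the differential equation divided by 1-z;
  the factor 1/(1-z) produces the partial sums. The terms are grouped for use in the t-derivative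
  below.\<close>

lemma inner_coeff_sum_identity:
  "t * (inner_coeff t (Suc n) + 2 * (\<Sum>k\<le>n. inner_coeff t k))
     + (real n + 1 - t) * inner_coeff t (Suc n) - real n * inner_coeff t n = 0"
proof (induction n)
  case 0
  show ?case by (simp add: algebra_simps)
next
  case (Suc n)
  then show ?case
    using inner_coeff_recurrence[of n t] by (simp add: algebra_simps)
qed

text \<open>Coefficientwise form of df/dt = -(1+z)/(1-z) f, where (1+z)/(1-z) = 1 + 2z + 2z^2 +
  ...\<close>

lemma inner_coeff_has_derivative:
  "((\<lambda>t. inner_coeff t n) has_real_derivative
     - (inner_coeff t n + 2 * (\<Sum>k<n. inner_coeff t k))) (at t)"
proof (induction t n rule: inner_coeff.induct)
  case (1 t)
  show ?case by (auto intro!: derivative_eq_intros)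
next
  case (2 t)
  show ?case by (auto intro!: derivative_eq_intros simp: algebra_simps)
next
  case (3 t n)
  let ?a = "inner_coeff t"
  have "((\<lambda>t. inner_coeff t (Suc (Suc n))) has_real_derivative
      (- 2 * ?a (Suc n) - 2 * (real n + 1 - t) * (?a (Suc n) + 2 * (\<Sum>k<Suc n. ?a k))
        + real n * (?a n + 2 * (\<Sum>k<n. ?a k))) / (real n + 2)) (at t)"
    unfolding inner_coeff.simps(3)
    by (rule derivative_eq_intros 3 refl | simp)+ (simp add: algebra_simps)
  also have "(- 2 * ?a (Suc n) - 2 * (real n + 1 - t) * (?a (Suc n) + 2 * (\<Sum>k<Suc n. ?a k))
        + real n * (?a n + 2 * (\<Sum>k<n. ?a k))) / (real n + 2)
      = - (?a (Suc (Suc n)) + 2 * (\<Sum>k<Suc (Suc n). ?a k))"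
    using inner_coeff_sum_identity[of t n] inner_coeff_recurrence[of n t]
    by (simp add: field_simps lessThan_Suc_atMost[symmetric])
  finally show ?case .
qed

text \<open>Avoids boundary values: the sum is 1 at \<open>t = 0\<close>, and its derivative in \<open>t\<close> is
  \<open>-2 (\<Sum>k\<le>n. a\<^sub>k)^2\<close>.\<close>

lemma sum_inner_coeff_squares_le_1:
  assumes "t \<ge> 0"
  shows "(\<Sum>k\<le>n. (inner_coeff t k)\<^sup>2) \<le> 1"
proof -
  have zero: "inner_coeff 0 (Suc k) = 0" for k
    by (induction k rule: induct_nat_012) (auto simp: inner_coeff.simps(3))
  \<comment> \<open>Telescoping: with S_k the sum of the coefficients up to index k, a_k (a_k + 2
    S_{k-1}) = S_k^2 - S_{k-1}^2.\<close>
  have square: "(\<Sum>k\<le>n. 2 * inner_coeff s k * - (inner_coeff s k + 2 * (\<Sum>j<k. inner_coeff s j)))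
      = - 2 * (\<Sum>k\<le>n. inner_coeff s k)\<^sup>2" for s
    by (induction n) (auto simp: algebra_simps power2_eq_square lessThan_Suc_atMost)
  have deriv: "((\<lambda>s. \<Sum>k\<le>n. (inner_coeff s k)\<^sup>2) has_real_derivative
      - 2 * (\<Sum>k\<le>n. inner_coeff s k)\<^sup>2) (at s)" for s
    unfolding square[symmetric]
    by (rule DERIV_sum) (auto intro!: derivative_eq_intros inner_coeff_has_derivative)
  have "(\<Sum>k\<le>n. (inner_coeff t k)\<^sup>2) \<le> (\<Sum>k\<le>n. (inner_coeff 0 k)\<^sup>2)"
    using assms
    by (rule DERIV_nonpos_imp_nonincreasing) (use deriv in fastforce)
  also have "(\<Sum>k\<le>n. (inner_coeff 0 k)\<^sup>2) = 1"
    by (induction n) (auto simp: zero)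
  finally show ?thesis .
qed

text \<open>Applied with M = a_n, p, q = a_{n+1}, a_{n-1} and r, s = a_{n+2}, a_{n-2}. The bound
  54/100 lies between 8/15, the limit of the argument, and 4/e^2; the threshold 40000 is
  generous.\<close>

lemma five_term_bound:
  fixes n y M p q r s :: real
  assumes n: "n \<ge> 40000"
    and rec1: "(n + 1) * p + (n - 1) * q = n * y * M"
    and rec2: "(n + 2) * r = (n * y + 2) * p - n * M"
    and rec3: "(n - 2) * s = (n * y - 2) * q - n * M"
    and squares: "M\<^sup>2 + p\<^sup>2 + q\<^sup>2 + r\<^sup>2 + s\<^sup>2 \<le> 1"
  shows "M\<^sup>2 \<le> 54 / 100"
proof (rule ccontr)
  assume "\<not> M\<^sup>2 \<le> 54 / 100"
  then have M: "M\<^sup>2 > 54 / 100" by simp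
  \<comment> \<open>The defects of the two limiting relations; both are shown to be O(1/n).\<close>
  define e1 where "e1 = p + q - y * M"
  define e2 where "e2 = r + s - (y\<^sup>2 - 2) * M"
  have "p\<^sup>2 \<le> 1\<^sup>2" "q\<^sup>2 \<le> 1\<^sup>2" "r\<^sup>2 \<le> 1\<^sup>2" "s\<^sup>2 \<le> 1\<^sup>2"
    using squares zero_le_power2[of M] zero_le_power2[of p] zero_le_power2[of q]
      zero_le_power2[of r] zero_le_power2[of s] unfolding one_power2 by linarith+
  then have le1: "\<bar>p\<bar> \<le> 1" "\<bar>q\<bar> \<le> 1" "\<bar>r\<bar> \<le> 1" "\<bar>s\<bar> \<le> 1"
    by (simp_all add: abs_le_square_iff[of _ "1::real", simplified])
  \<comment> \<open>As t is arbitrary, y has no a priori bound. Keeping M away from 0 turns the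
    bound on y M into one on y, which makes the error \<open>e2\<close> uniform in t.\<close>
  have "(7/10)\<^sup>2 \<le> M\<^sup>2"
    using M by (simp add: power2_eq_square)
  then have absM: "\<bar>M\<bar> \<ge> 7/10"
    using abs_le_square_iff[of "7/10" M] by simp
  have ne1: "n * e1 = - (p - q)"
    using rec1 by (simp add: e1_def algebra_simps)
  have ne2: "n * e2 = (2 - y) * (p - q) - 2 * (r - s)"
  proof -
    have "n * e2 = y * (n * (p + q)) + 2 * (p - q) - 2 * n * M - 2 * (r - s) - n * (y\<^sup>2 - 2) * M"
      using rec2 rec3 by (simp add: e2_def algebra_simps)
    also have "n * (p + q) = n * y * M - (p - q)"
      using rec1 by (simp add: algebra_simps)
    finally show ?thesis
      by (simp add: algebra_simps power2_eq_square)
  qed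
  have "n * \<bar>e1\<bar> \<le> 2"
    using arg_cong[OF ne1, of abs] le1 n by (simp add: abs_mult)
  then have e1: "\<bar>e1\<bar> \<le> 2 / n"
    using n by (simp add: field_simps)
  have small: "1 / n \<le> 1 / 40000"
    using n by (simp add: field_simps)
  then have yM: "\<bar>y * M\<bar> \<le> 3"
    using e1 le1 unfolding e1_def by linarith
  have "\<bar>y\<bar> * (7/10) \<le> \<bar>y\<bar> * \<bar>M\<bar>"
    using absM by (intro mult_left_mono) auto
  then have y: "\<bar>y\<bar> \<le> 6"
    using yM by (simp add: abs_mult)
  have "\<bar>(2 - y) * (p - q)\<bar> \<le> 8 * 2"
    unfolding abs_mult using y le1 by (intro mult_mono) linarith+
  moreover have "\<bar>2 * (r - s)\<bar> \<le> 4"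
    using le1(3,4) by (simp add: abs_if split: if_splits)
  ultimately have "\<bar>n * e2\<bar> \<le> 20"
    using abs_triangle_ineq4[of "(2 - y) * (p - q)" "2 * (r - s)"] unfolding ne2 by linarith
  then have e2: "\<bar>e2\<bar> \<le> 20 / n"
    using n by (simp add: abs_mult field_simps)
  then have y2M: "\<bar>(y\<^sup>2 - 2) * M\<bar> \<le> 3"
    using small le1 unfolding e2_def by linarith
  have "\<bar>y * M * e1\<bar> \<le> 3 * (2 / n)"
    unfolding abs_mult[of "y * M"] using yM e1 by (intro mult_mono) auto
  moreover have "(p + q)\<^sup>2 = (y * M)\<^sup>2 + 2 * (y * M * e1) + e1\<^sup>2"
    by (simp add: e1_def power2_eq_square algebra_simps)
  moreover have "(p + q)\<^sup>2 \<le> 2 * (p\<^sup>2 + q\<^sup>2)"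
    using zero_le_power2[of "p - q"] by (simp add: power2_eq_square algebra_simps)
  ultimately have P: "2 * (p\<^sup>2 + q\<^sup>2) \<ge> (y * M)\<^sup>2 - 12 / n"
    using zero_le_power2[of e1] by linarith
  have "\<bar>(y\<^sup>2 - 2) * M * e2\<bar> \<le> 3 * (20 / n)"
    unfolding abs_mult[of "(y\<^sup>2 - 2) * M"] using y2M e2 by (intro mult_mono) auto
  moreover have "(r + s)\<^sup>2 = ((y\<^sup>2 - 2) * M)\<^sup>2 + 2 * ((y\<^sup>2 - 2) * M * e2) + e2\<^sup>2"
    by (simp add: e2_def power2_eq_square algebra_simps)
  moreover have "(r + s)\<^sup>2 \<le> 2 * (r\<^sup>2 + s\<^sup>2)"
    using zero_le_power2[of "r - s"] by (simp add: power2_eq_square algebra_simps)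
  ultimately have Q: "2 * (r\<^sup>2 + s\<^sup>2) \<ge> ((y\<^sup>2 - 2) * M)\<^sup>2 - 120 / n"
    using zero_le_power2[of e2] by linarith
  \<comment> \<open>Completing the square in y^2: the bracket 1 + y^2/2 + (y^2-2)^2/2 equals 15/8 +
    (y^2 - 3/2)^2/2. The error 66/n below is 6/n from \<open>P\<close> plus 60/n from
    \<open>Q\<close>.\<close>
  have "15 / 8 * M\<^sup>2 \<le> 15 / 8 * M\<^sup>2 + 1 / 2 * ((y\<^sup>2 - 3 / 2) * M)\<^sup>2"
    by simp
  also have "\<dots> = M\<^sup>2 + (y * M)\<^sup>2 / 2 + ((y\<^sup>2 - 2) * M)\<^sup>2 / 2"
    by (simp add: power2_eq_square field_simps)
  also have "\<dots> \<le> 1 + 66 * (1 / n)"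
    using P Q squares by simp
  finally show False
    using M small by linarith
qed

lemma inner_coeff_square_le:
  assumes "t > 0" "n \<ge> 40000"
  shows "(inner_coeff t n)\<^sup>2 \<le> 54 / 100"
proof -
  obtain m where n: "n = Suc (Suc m)"
    using assms(2) by (intro that[of "n - 2"]) simp
  let ?a = "inner_coeff t" and ?x = "real n"
  define y where "y = 2 * (?x - t) / ?x"
  have xy: "?x * y = 2 * (?x - t)"
    using assms by (simp add: y_def)
  show ?thesis
  proof (rule five_term_bound)
    show "?x \<ge> 40000" using assms by simp
    show "(?x + 1) * ?a (Suc n) + (?x - 1) * ?a (Suc m) = ?x * y * ?a n"
      using inner_coeff_recurrence[of "Suc m" t] unfolding xy by (simp add: n algebra_simps)
    show "(?x + 2) * ?a (Suc (Suc n)) = (?x * y + 2) * ?a (Suc n) - ?x * ?a n"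
      using inner_coeff_recurrence[of n t] unfolding xy by (simp add: n algebra_simps)
    show "(?x - 2) * ?a m = (?x * y - 2) * ?a (Suc m) - ?x * ?a n"
      using inner_coeff_recurrence[of m t] unfolding xy by (simp add: n algebra_simps)
    have "(\<Sum>k\<in>{m..Suc (Suc n)}. (?a k)\<^sup>2) \<le> (\<Sum>k\<le>Suc (Suc n). (?a k)\<^sup>2)"
      by (rule sum_mono2) auto
    also have "\<dots> \<le> 1"
      using assms by (intro sum_inner_coeff_squares_le_1) simp
    finally show "(?a n)\<^sup>2 + (?a (Suc n))\<^sup>2 + (?a (Suc m))\<^sup>2 + (?a (Suc (Suc n)))\<^sup>2 + (?a m)\<^sup>2 \<le> 1"
      by (simp add: n sum.cl_ivl_Suc)
  qed
qed

theorem theorem3: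
  shows "\<exists>N::nat. \<forall>n\<ge>N. \<forall>t::real. t > 0 \<longrightarrow>
    cmod (fps_nth (fps_expansion (\<lambda>z::complex. exp (- (of_real t * ((1 + z) / (1 - z))))) 0) n)
      \<le> 2 / exp 1"
proof (intro exI[of _ 40000] allI impI)
  fix n :: nat and t :: real
  assume "n \<ge> 40000" "t > 0"
  then have "(inner_coeff t n)\<^sup>2 \<le> 54 / 100"
    by (intro inner_coeff_square_le)
  \<comment> \<open>2.72 is a rational upper bound for e, tight enough that (2/2.72)^2 = 0.5406...
    still exceeds 0.54.\<close>
  also have "\<dots> \<le> (2 / (272 / 100))\<^sup>2"
    by (simp add: power2_eq_square)
  finally have "\<bar>inner_coeff t n\<bar> \<le> 2 / (272 / 100)"
    using abs_le_square_iff[of "inner_coeff t n" "2 / (272 / 100)"] by simp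
  also have "\<dots> \<le> 2 / exp 1"
    using e_less_272 by (intro divide_left_mono) auto
  finally show "cmod (fps_nth (fps_expansion
      (\<lambda>z::complex. exp (- (of_real t * ((1 + z) / (1 - z))))) 0) n) \<le> 2 / exp 1"
    unfolding fps_nth_inner_function by simp
qed

end
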